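(* Let $H$ be an $n$-vertex complete multipartite graph, let $t\ge2$ with $n\ge t$, and let $\mathbf{c}=(c_i)_{i\ge1}$ be a sequence of nonnegative real numbers. (i) If $c_{i+1}-c_i\le c_t$ for every $i\ge t$, then $\mathrm{cov}^*_t(H,\mathbf{c})\le\mathrm{cov}^*_t(T_{n,t},\mathbf{c})=\mathrm{cov}_t(T_{n,t},\mathbf{c})$. (ii) If $2c_i\ge c_{i-1}+c_{i+1}$ for every $i\ge2$, then $\mathrm{dec}^*_2(H,\mathbf{c})\le\mathrm{dec}^*_2(T_{n,2},\mathbf{c})=\mathrm{dec}_2(T_{n,2},\mathbf{c})$.
   Context: All graphs are finite and simple. A clique of $G$ is a nonempty set of pairwise adjacent vertices; $\mathcal{K}(G)$ is the set of cliques of $G$ and $\mathcal{K}_t(G)$ the set of cliques with exactly $t$ vertices. For $f:\mathcal{K}(G)\to\mathbb{R}$, its $\mathbf{c}$-cost is $\|f\|_{\mathbf{c}}=\sum_{K\in\mathcal{K}(G)}c_{|K|}f(K)$. A $t$-clique cover (resp. decomposition) of $G$ is $f:\mathcal{K}(G)\to\{0,1\}$ with $\sum_{K\in\mathcal{K}(G),\,T\subseteq K}f(K)\ge1$ (resp. $=1$) for every $T\in\mathcal{K}_t(G)$; fractional versions allow $f:\mathcal{K}(G)\to\mathbb{R}_{\ge0}$. $\mathrm{cov}_t(G,\mathbf{c})$, $\mathrm{dec}_t(G,\mathbf{c})$, $\mathrm{cov}^*_t(G,\mathbf{c})$, $\mathrm{dec}^*_t(G,\mathbf{c})$ denote the minimum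 $\mathbf{c}$-cost of a $t$-clique cover, $t$-clique decomposition, fractional $t$-clique cover, fractional $t$-clique decomposition of $G$, respectively. For $n\ge k$, $T_{n,k}$ is the complete $k$-partite graph on $n$ vertices with part sizes differing by at most one. *)

theory Defs
  imports Complex_Main "HOL-Library.Disjoint_Sets"
begin

record 'a sgraph =
  verts :: "'a set"
  edges :: "'a set set"

definition simple_graph :: "'a sgraph \<Rightarrow> bool" where
  "simple_graph G \<longleftrightarrow> finite (verts G) \<and> (\<forall>e\<in>edges G. e \<subseteq> verts G \<and> card e = 2)"

definition cliques :: "'a sgraph \<Rightarrow> 'a set set" where
  "cliques G = {K. K \<noteq> {} \<and> K \<subseteq> verts G \<and> (\<forall>u\<in>K. \<forall>v\<in>K. u \<noteq> v \<longrightarrow> {u, v} \<in> edges G)}"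

definition cliques_of_size :: "'a sgraph \<Rightarrow> nat \<Rightarrow> 'a set set" where
  "cliques_of_size G t = {K \<in> cliques G. card K = t}"

text \<open>Functions on the cliques of a graph are represented by functions on all vertex sets;
  only the values on cliques matter below. As cliques are nonempty, \<open>c 0\<close> is never used.\<close>

definition clique_cost :: "'a sgraph \<Rightarrow> (nat \<Rightarrow> real) \<Rightarrow> ('a set \<Rightarrow> real) \<Rightarrow> real" where
  "clique_cost G c f = (\<Sum>K\<in>cliques G. c (card K) * f K)"

definition clique_cover :: "'a sgraph \<Rightarrow> nat \<Rightarrow> ('a set \<Rightarrow> real) \<Rightarrow> bool" where
  "clique_cover G t f \<longleftrightarrow>
     (\<forall>K\<in>cliques G. f K \<in> {0, 1}) \<and>
     (\<forall>T\<in>cliques_of_size G t. (\<Sum>K | K \<in> cliques G \<and> T \<subseteq> K. f K) \<ge> 1)"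

definition clique_decomposition :: "'a sgraph \<Rightarrow> nat \<Rightarrow> ('a set \<Rightarrow> real) \<Rightarrow> bool" where
  "clique_decomposition G t f \<longleftrightarrow>
     (\<forall>K\<in>cliques G. f K \<in> {0, 1}) \<and>
     (\<forall>T\<in>cliques_of_size G t. (\<Sum>K | K \<in> cliques G \<and> T \<subseteq> K. f K) = 1)"

definition frac_clique_cover :: "'a sgraph \<Rightarrow> nat \<Rightarrow> ('a set \<Rightarrow> real) \<Rightarrow> bool" where
  "frac_clique_cover G t f \<longleftrightarrow>
     (\<forall>K\<in>cliques G. f K \<ge> 0) \<and>
     (\<forall>T\<in>cliques_of_size G t. (\<Sum>K | K \<in> cliques G \<and> T \<subseteq> K. f K) \<ge> 1)"

definition frac_clique_decomposition :: "'a sgraph \<Rightarrow> nat \<Rightarrow> ('a set \<Rightarrow> real) \<Rightarrow> bool" where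
  "frac_clique_decomposition G t f \<longleftrightarrow>
     (\<forall>K\<in>cliques G. f K \<ge> 0) \<and>
     (\<forall>T\<in>cliques_of_size G t. (\<Sum>K | K \<in> cliques G \<and> T \<subseteq> K. f K) = 1)"

text \<open>The minima are genuine minima, not infima: \<open>LEAST\<close> yields a specified value only if
  the minimum is attained (which is the case for nonnegative \<open>c\<close>).\<close>

definition cov :: "nat \<Rightarrow> 'a sgraph \<Rightarrow> (nat \<Rightarrow> real) \<Rightarrow> real" where
  "cov t G c = (LEAST x. \<exists>f. clique_cover G t f \<and> x = clique_cost G c f)"

definition dec :: "nat \<Rightarrow> 'a sgraph \<Rightarrow> (nat \<Rightarrow> real) \<Rightarrow> real" where
  "dec t G c = (LEAST x. \<exists>f. clique_decomposition G t f \<and> x = clique_cost G c f)"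

definition frac_cov :: "nat \<Rightarrow> 'a sgraph \<Rightarrow> (nat \<Rightarrow> real) \<Rightarrow> real" where
  "frac_cov t G c = (LEAST x. \<exists>f. frac_clique_cover G t f \<and> x = clique_cost G c f)"

definition frac_dec :: "nat \<Rightarrow> 'a sgraph \<Rightarrow> (nat \<Rightarrow> real) \<Rightarrow> real" where
  "frac_dec t G c = (LEAST x. \<exists>f. frac_clique_decomposition G t f \<and> x = clique_cost G c f)"

definition complete_multipartite_with :: "'a sgraph \<Rightarrow> 'a set set \<Rightarrow> bool" where
  "complete_multipartite_with G P \<longleftrightarrow>
     simple_graph G \<and> partition_on (verts G) P \<and>
     (\<forall>u\<in>verts G. \<forall>v\<in>verts G. {u, v} \<in> edges G \<longleftrightarrow> \<not> (\<exists>A\<in>P. u \<in> A \<and> v \<in> A))"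

definition complete_multipartite :: "'a sgraph \<Rightarrow> bool" where
  "complete_multipartite G \<longleftrightarrow> (\<exists>P. complete_multipartite_with G P)"

text \<open>\<open>is_turan_graph n k G\<close> says that \<open>G\<close> is a copy of \<open>T\<^sub>n\<^sub>,\<^sub>k\<close>. Parts are nonempty by
  \<^const>\<open>partition_on\<close>, which is no restriction for \<open>n \<ge> k\<close>.\<close>

definition is_turan_graph :: "nat \<Rightarrow> nat \<Rightarrow> 'a sgraph \<Rightarrow> bool" where
  "is_turan_graph n k G \<longleftrightarrow> card (verts G) = n \<and>
     (\<exists>P. complete_multipartite_with G P \<and> card P = k \<and>
          (\<forall>A\<in>P. \<forall>B\<in>P. card A \<le> card B + 1))"

lemma turan_graph_exists:
  assumes "1 \<le> k" "k \<le> n"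
  shows "\<exists>G :: nat sgraph. is_turan_graph n k G"
proof -
  define part where "part r = {i. i < n \<and> i mod k = r}" for r
  define G :: "nat sgraph" where
    "G = \<lparr>verts = {..<n}, edges = {{u, v} |u v. u < n \<and> v < n \<and> u mod k \<noteq> v mod k}\<rparr>"
  have self: "r \<in> part r" if "r < k" for r
    using that assms by (auto simp: part_def)
  have disj: "part r \<inter> part s = {}" if "r \<noteq> s" for r s
    using that by (auto simp: part_def)
  have inj: "inj_on part {..<k}"
    by (rule inj_onI) (metis self disj IntI empty_iff lessThan_iff)
  have simple: "simple_graph G"
    by (auto simp: simple_graph_def G_def card_2_iff)
  have partition: "partition_on (verts G) (part ` {..<k})"
  proof (rule partition_onI)
    show "\<Union> (part ` {..<k}) = verts G"
      using assms by (auto simp: part_def G_def)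
    show "disjnt A B" if "A \<in> part ` {..<k}" "B \<in> part ` {..<k}" "A \<noteq> B" for A B
      using that by (auto simp: disjnt_def part_def)
    show "{} \<notin> part ` {..<k}"
      using self by (auto simp: image_iff)
  qed
  have adj: "{u, v} \<in> edges G \<longleftrightarrow> \<not> (\<exists>A\<in>part ` {..<k}. u \<in> A \<and> v \<in> A)"
    if "u \<in> verts G" "v \<in> verts G" for u v
    using that assms by (auto simp: G_def part_def doubleton_eq_iff)
  have balanced: "card (part r) \<le> card (part s) + 1" if "r < k" "s < k" for r s
  proof -
    have "(\<lambda>i. i - r + s - k) ` (part r - {r}) \<subseteq> part s"
    proof
      fix j assume "j \<in> (\<lambda>i. i - r + s - k) ` (part r - {r})"
      then obtain i where i: "i < n" "i mod k = r" "i \<noteq> r" and j: "j = i - r + s - k"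
        by (auto simp: part_def)
      define q where "q = i div k"
      have iq: "i = q * k + r" using i(2) by (metis q_def div_mult_mod_eq)
      have "q \<noteq> 0" using iq i(3) by auto
      then obtain p where p: "q = Suc p" by (cases q) auto
      have "j = p * k + s" using j iq p by simp
      moreover have "p * k + s < n" using i(1) iq p that by simp
      ultimately show "j \<in> part s" using that by (simp add: part_def)
    qed
    moreover have "inj_on (\<lambda>i. i - r + s - k) (part r - {r})"
    proof (rule inj_onI)
      have ge: "i \<ge> k + r" if i: "i \<in> part r - {r}" for i
      proof -
        have "i = (i div k) * k + r" using i by (auto simp: part_def)
        moreover have "i div k \<noteq> 0"
        proof
          assume "i div k = 0"
          with calculation have "i = r" by simp
          with i show False by simp
        qed
        then have "1 * k \<le> (i div k) * k" by (intro mult_le_mono1) simp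
        ultimately show ?thesis by linarith
      qed
      fix i j assume "i \<in> part r - {r}" "j \<in> part r - {r}" "i - r + s - k = j - r + s - k"
      with ge[of i] ge[of j] show "i = j" by simp
    qed
    moreover have "finite (part r)" "finite (part s)" by (auto simp: part_def)
    ultimately have "card (part r - {r}) \<le> card (part s)"
      by (metis card_inj_on_le)
    with self[OF that(1)] \<open>finite (part r)\<close> show ?thesis by (simp add: card_Diff_singleton)
  qed
  have "is_turan_graph n k G"
    unfolding is_turan_graph_def complete_multipartite_with_def
    using simple partition adj balanced card_image[OF inj]
    by (intro conjI exI[of _ "part ` {..<k}"]) (auto simp: G_def)
  then show ?thesis by blast
qed

end

theory Submission
  imports Defs "HOL-Analysis.Function_Topology"
begin

text \<open>
  Every clique of a complete multipartite graph is a transversal of the set of parts it hits, so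
  a weight \<open>W S\<close> on each set \<open>S\<close> of parts may be spread uniformly over the transversals of \<open>S\<close>.
  A \<open>t\<close>-clique with set of parts \<open>R\<close> then receives the total weight of all \<open>S \<supseteq> R\<close> divided by
  the product of the part sizes in \<open>R\<close>.

  (i) Let \<open>Q\<close> consist of \<open>t - 1\<close> largest parts, let \<open>A\<close> be the product of their sizes and \<open>m\<close> the
  largest size of the other parts. For each \<open>\<theta> = 1, \<dots>, m\<close> put weight \<open>A\<close> on the set of parts of
  size at least \<open>\<theta>\<close>. This gives a fractional cover, and as \<open>c\<^sub>i \<le> (i - t + 1) c\<^sub>t\<close>, its cost is at
  most \<open>c\<^sub>t\<close> times the product of \<open>A\<close> and the number of vertices outside \<open>Q\<close>.

  (ii) Let \<open>a\<close> be the largest part size, and include each part \<open>B\<close> in \<open>S\<close> independently with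
  probability \<open>|B|/a\<close>. The weight \<open>W S = a\<^sup>2 Pr(S)\<close> gives a fractional \<open>2\<close>-decomposition;
  since \<open>c\<^sub>i \<le> (i - 1) c\<^sub>2\<close>, and since a part of size \<open>a\<close> is always included, its cost is at most
  \<open>c\<^sub>2 a\<^sup>2 (n/a - 1) = c\<^sub>2 a (n - a)\<close> once singletons are dropped.

  Both bounds are \<open>c\<^sub>t\<close> times a product of \<open>t\<close> natural numbers with sum \<open>n\<close>, hence at most \<open>c\<^sub>t\<close>
  times the number of \<open>t\<close>-cliques of the Turan graph. There the \<open>t\<close>-cliques are maximal, so all
  the costs are equal to this value.
\<close>

section \<open>Inequalities for products of sizes, and a product expansion\<close>

text \<open>With \<open>q\<close> the minimum of \<open>g\<close> and \<open>r = 1 + 1/q\<close>, the inequality \<open>x \<le> q r\<^sup>x\<^sup>-\<^sup>q\<close> holds for all natural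
  numbers \<open>x\<close>, with equality at \<open>q\<close> and \<open>q + 1\<close>.\<close>

lemma balanced_prod_ge:
  fixes f :: "'i \<Rightarrow> nat" and g :: "'j \<Rightarrow> nat"
  assumes fin: "finite I" "finite J" and card: "card I = card J" and sum: "sum f I = sum g J"
    and pos: "\<And>j. j \<in> J \<Longrightarrow> g j > 0"
    and balanced: "\<And>i j. i \<in> J \<Longrightarrow> j \<in> J \<Longrightarrow> g i \<le> g j + 1"
  shows "prod f I \<le> prod g J"
proof (cases "J = {}")
  case True
  with fin card show ?thesis by simp
next
  case False
  define q where "q = Min (g ` J)"
  define r where "r = 1 + 1 / real q"
  have q_in: "q \<in> g ` J" using False fin by (simp add: q_def)
  have q0: "q > 0" using q_in pos by auto
  have r1: "r > 1" using q0 by (simp add: r_def)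
  have le: "real x * r ^ q \<le> real q * r ^ x" for x :: nat
  proof (cases "q \<le> x")
    case True
    then obtain k where k: "x = q + k" using le_Suc_ex by blast
    have "1 + real k * (1 / real q) \<le> r ^ k"
      unfolding r_def by (rule Bernoulli_inequality) (simp add: order_trans[of _ 0])
    with q0 have "real x \<le> real q * r ^ k" by (simp add: k field_simps)
    then show ?thesis using r1 by (simp add: k power_add mult_ac)
  next
    case False
    then obtain k where k: "q = x + k" using le_Suc_ex nat_le_linear by blast
    \<comment> \<open>For \<open>x < q\<close> Bernoulli's inequality is applied to the base
      \<open>1 / r = 1 - 1 / (q + 1)\<close>; the result suffices because
      \<open>k / (q + 1) \<le> k / q\<close>.\<close>
    have "1 + real k * (- (1 / (real q + 1))) \<le> (1 + - (1 / (real q + 1))) ^ k"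
      by (rule Bernoulli_inequality) (simp add: field_simps)
    moreover have "1 + - (1 / (real q + 1)) = 1 / r"
      using q0 by (simp add: r_def field_simps)
    ultimately have "1 - real k / (real q + 1) \<le> 1 / r ^ k"
      by (simp add: power_divide)
    moreover have "real x / real q \<le> 1 - real k / (real q + 1)"
    proof -
      have "real k / (real q + 1) \<le> real k / real q"
        using q0 by (intro divide_left_mono) auto
      moreover have "real x = real q - real k" using k by simp
      then have "real x / real q = 1 - real k / real q" using q0 by (simp add: diff_divide_distrib)
      ultimately show ?thesis by linarith
    qed
    ultimately have "real x / real q \<le> 1 / r ^ k" by linarith
    then have "real x * r ^ k \<le> real q" using q0 r1 by (simp add: field_simps)
    then have "real x * r ^ k * r ^ x \<le> real q * r ^ x" using r1 by simp
    then show ?thesis by (simp add: k power_add mult_ac)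
  qed
  have eq: "real (g j) * r ^ q = real q * r ^ g j" if "j \<in> J" for j
  proof -
    have "q \<le> g j" using that fin by (simp add: q_def)
    moreover have "g j \<le> q + 1" using q_in balanced that by auto
    ultimately have "g j = q \<or> g j = q + 1" by linarith
    then show ?thesis using q0 by (auto simp: r_def field_simps)
  qed
  \<comment> \<open>The pointwise inequality is multiplied over \<open>I\<close>. The resulting
    bound depends only on the number of factors and the sum of the exponents, so \<open>f\<close>
    can be exchanged for \<open>g\<close>, where equality holds.\<close>
  have "real (prod f I) * (r ^ q) ^ card I = (\<Prod>i\<in>I. real (f i) * r ^ q)"
    by (simp add: prod.distrib)
  also have "\<dots> \<le> (\<Prod>i\<in>I. real q * r ^ f i)"
    using r1 le by (intro prod_mono) auto
  also have "\<dots> = (\<Prod>j\<in>J. real q * r ^ g j)"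
    using card sum by (simp add: prod.distrib power_sum[symmetric])
  also have "\<dots> = (\<Prod>j\<in>J. real (g j) * r ^ q)"
    using eq by (intro prod.cong) auto
  also have "\<dots> = real (prod g J) * (r ^ q) ^ card I"
    by (simp add: prod.distrib card)
  finally have "real (prod f I) \<le> real (prod g J)" using r1 by simp
  then show ?thesis by linarith
qed

text \<open>\<open>J - Q\<close> and \<open>Q - J\<close> are equinumerous; every weight in the
  former is at most \<open>m\<close>, every weight in the latter at least \<open>m\<close>.\<close>

lemma prod_le_top:
  fixes w :: "'a \<Rightarrow> nat"
  assumes fin: "finite P" and sub: "Q \<subseteq> P" "J \<subseteq> P" and card: "card J = card Q"
    and top: "\<And>x. x \<in> Q \<Longrightarrow> m \<le> w x" "\<And>x. x \<in> P - Q \<Longrightarrow> w x \<le> m"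
  shows "prod w J \<le> prod w Q"
proof -
  have f: "finite Q" "finite J" using fin sub finite_subset by auto
  have c: "card (J - Q) = card (Q - J)"
    using card f by (simp add: card_Diff_subset_Int Int_commute)
  have "prod w (J - Q) \<le> (\<Prod>x\<in>J - Q. m)"
    using top sub by (intro prod_mono) auto
  also have "\<dots> = (\<Prod>x\<in>Q - J. m)" by (simp add: c)
  also have "\<dots> \<le> prod w (Q - J)"
    using top by (intro prod_mono) auto
  finally have "prod w (J \<inter> Q) * prod w (J - Q) \<le> prod w (J \<inter> Q) * prod w (Q - J)" by simp
  also have "\<dots> = prod w Q"
    using prod.Int_Diff[OF f(1), of w J] by (simp add: Int_commute)
  finally show ?thesis using prod.Int_Diff[OF f(2), of w Q] by simp
qed

text \<open>Greedy choice: a heaviest remaining element is added \<open>k\<close> times. The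
  threshold \<open>m\<close> is the largest weight left over, which exists because
  \<open>k < card P\<close>.\<close>

lemma obtain_top_subset:
  fixes w :: "'a \<Rightarrow> nat"
  assumes "finite P" "k < card P"
  obtains Q m where "Q \<subseteq> P" "card Q = k" "\<And>x. x \<in> Q \<Longrightarrow> m \<le> w x"
    "\<And>x. x \<in> P - Q \<Longrightarrow> w x \<le> m" "\<exists>x\<in>P - Q. w x = m"
proof -
  have "\<exists>Q. Q \<subseteq> P \<and> card Q = k \<and> (\<forall>x\<in>Q. \<forall>y\<in>P - Q. w y \<le> w x)"
    using assms(2)
  proof (induction k)
    case 0
    show ?case by (rule exI[of _ "{}"]) auto
  next
    case (Suc k)
    then obtain Q where Q: "Q \<subseteq> P" "card Q = k" "\<forall>x\<in>Q. \<forall>y\<in>P - Q. w y \<le> w x" by auto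
    have finQ: "finite Q" using Q(1) assms(1) finite_subset by auto
    have "P - Q \<noteq> {}" using Q Suc.prems finQ card_mono by fastforce
    then have "Max (w ` (P - Q)) \<in> w ` (P - Q)" using assms(1) by (intro Max_in) auto
    then obtain z where z: "z \<in> P - Q" "w z = Max (w ` (P - Q))" by auto
    then have "\<forall>y\<in>P - Q. w y \<le> w z" using assms(1) by auto
    with Q z finQ show ?case by (intro exI[of _ "insert z Q"]) auto
  qed
  then obtain Q where Q: "Q \<subseteq> P" "card Q = k" "\<forall>x\<in>Q. \<forall>y\<in>P - Q. w y \<le> w x" by auto
  have "P - Q \<noteq> {}" using Q assms by auto
  then have "Max (w ` (P - Q)) \<in> w ` (P - Q)" using assms(1) by (intro Max_in) auto
  then obtain z where z: "z \<in> P - Q" "w z = Max (w ` (P - Q))" by auto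
  then have "\<forall>y\<in>P - Q. w y \<le> w z" using assms(1) by auto
  with Q z(1) show ?thesis by (intro that[of Q "w z"]) blast+
qed

text \<open>Expanding the product over \<open>P - R\<close> gives one term for each
  \<open>S - R\<close>. If \<open>x b + y b = 1\<close> throughout, this is the probability that a
  random set, including each \<open>b\<close> independently with probability \<open>x b\<close>,
  contains \<open>R\<close>.\<close>

lemma sum_Pow_prod:
  fixes x y :: "'a \<Rightarrow> 'b :: comm_semiring_1"
  assumes "finite P" "R \<subseteq> P"
  shows "(\<Sum>S | R \<subseteq> S \<and> S \<subseteq> P. prod x S * prod y (P - S)) = prod x R * (\<Prod>b\<in>P - R. x b + y b)"
proof -
  have fR: "finite R" using assms finite_subset by auto
  have bij: "bij_betw ((\<union>) R) (Pow (P - R)) {S. R \<subseteq> S \<and> S \<subseteq> P}"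
    by (rule bij_betw_byWitness[of _ "\<lambda>S. S - R"]) (use assms in auto)
  have "(\<Sum>S | R \<subseteq> S \<and> S \<subseteq> P. prod x S * prod y (P - S))
      = (\<Sum>S\<in>Pow (P - R). prod x (R \<union> S) * prod y (P - (R \<union> S)))"
    by (rule sum.reindex_bij_betw[OF bij, symmetric])
  also have "\<dots> = (\<Sum>S\<in>Pow (P - R). prod x R * (prod x S * prod y (P - R - S)))"
  proof (rule sum.cong[OF refl])
    fix S assume S: "S \<in> Pow (P - R)"
    then have "finite S" using assms by (meson PowD finite_Diff finite_subset)
    then have "prod x (R \<union> S) = prod x R * prod x S"
      using S fR by (intro prod.union_disjoint) auto
    moreover have "P - (R \<union> S) = P - R - S" by blast
    ultimately show "prod x (R \<union> S) * prod y (P - (R \<union> S)) = prod x R * (prod x S * prod y (P - R - S))"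
      by (simp add: mult.assoc)
  qed
  also have "\<dots> = prod x R * (\<Prod>b\<in>P - R. x b + y b)"
    using assms by (simp add: prod_add sum_distrib_left)
  finally show ?thesis .
qed

section \<open>Transversals of disjoint families: counting and extension\<close>

definition transversals :: "'a set set \<Rightarrow> 'a set set" where
  "transversals S = {K. K \<subseteq> \<Union>S \<and> (\<forall>B\<in>S. \<exists>x. K \<inter> B = {x})}"

lemma transversals_subset: "K \<in> transversals S \<Longrightarrow> K \<subseteq> \<Union>S"
  by (simp add: transversals_def)

text \<open>The induction step for counting: deleting the point in \<open>A\<close> leaves a
  transversal of \<open>S\<close>, as \<open>A\<close> is disjoint from the members of
  \<open>S\<close>.\<close>

lemma transversals_insert:
  assumes "\<And>B. B \<in> S \<Longrightarrow> A \<inter> B = {}"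
  shows "transversals (insert A S) = (\<lambda>(x, K). insert x K) ` (A \<times> transversals S)"
proof (intro equalityI subsetI)
  fix K assume K: "K \<in> transversals (insert A S)"
  then obtain x where x: "K \<inter> A = {x}"
    unfolding transversals_def by auto
  have eq: "(K - A) \<inter> B = K \<inter> B" if "B \<in> S" for B using assms that by blast
  have "K - A \<in> transversals S"
    using K unfolding transversals_def by (auto simp: eq)
  moreover have "K = insert x (K - A)" "x \<in> A" using x by auto
  ultimately show "K \<in> (\<lambda>(x, K). insert x K) ` (A \<times> transversals S)"
    by (intro image_eqI[of _ _ "(x, K - A)"]) simp_all
next
  fix K assume "K \<in> (\<lambda>(x, K). insert x K) ` (A \<times> transversals S)"
  then obtain x L where K: "K = insert x L" "x \<in> A" "L \<in> transversals S" by auto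
  have "L \<inter> A = {}" using transversals_subset[OF K(3)] assms by blast
  then have "K \<inter> A = {x}" using K by auto
  moreover have "K \<inter> B = L \<inter> B" if "B \<in> S" for B using assms that K by blast
  ultimately show "K \<in> transversals (insert A S)"
    using K(1,3) unfolding transversals_def by auto
qed

lemma card_transversals:
  assumes "finite S" "disjoint S" "\<And>B. B \<in> S \<Longrightarrow> finite B"
  shows "card (transversals S) = (\<Prod>B\<in>S. card B)"
  using assms
proof (induction S)
  case empty
  have "transversals ({} :: 'a set set) = {{}}" by (auto simp: transversals_def)
  then show ?case by simp
next
  case (insert A S)
  have disj: "A \<inter> B = {}" if "B \<in> S" for B
    using insert.prems(1) insert.hyps(2) that by (auto simp: disjoint_def)
  have out: "K \<inter> A = {}" if "K \<in> transversals S" for K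
    using that disj by (fast dest: transversals_subset)
  \<comment> \<open>The pair is recovered from \<open>insert x K\<close>, since \<open>x\<close> is
    its only element in \<open>A\<close>.\<close>
  have "inj_on (\<lambda>(x, K). insert x K) (A \<times> transversals S)"
  proof (rule inj_onI, clarify)
    fix x y K L assume *: "x \<in> A" "y \<in> A" "K \<in> transversals S" "L \<in> transversals S"
      "insert x K = insert y L"
    from * out[of K] out[of L] have "x = y" by blast
    moreover have "x \<notin> K" "y \<notin> L" using * out[of K] out[of L] by blast+
    ultimately show "x = y \<and> K = L" using *(5) by (simp add: insert_ident)
  qed
  then have "card (transversals (insert A S)) = card A * card (transversals S)"
    by (simp add: transversals_insert[OF disj] card_image card_cartesian_product)
  with insert show ?case by (simp add: disjoint_def)
qed

lemma card_transversal:
  assumes "finite S" "disjoint S" "K \<in> transversals S"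
  shows "card K = card S"
proof -
  have one: "\<exists>x. K \<inter> B = {x}" if "B \<in> S" for B using assms(3) that by (simp add: transversals_def)
  have "K = (\<Union>B\<in>S. K \<inter> B)" using transversals_subset[OF assms(3)] by blast
  also have "card \<dots> = (\<Sum>B\<in>S. card (K \<inter> B))"
  proof (rule card_UN_disjoint[OF assms(1)])
    show "\<forall>B\<in>S. finite (K \<inter> B)" using one by (metis finite.emptyI finite_insert)
    show "\<forall>A\<in>S. \<forall>B\<in>S. A \<noteq> B \<longrightarrow> (K \<inter> A) \<inter> (K \<inter> B) = {}"
      using assms(2) by (auto simp: disjoint_def)
  qed
  also have "\<dots> = (\<Sum>B\<in>S. 1)"
  proof (rule sum.cong[OF refl])
    fix B assume "B \<in> S"
    with one obtain x where "K \<inter> B = {x}" by blast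
    then show "card (K \<inter> B) = 1" by simp
  qed
  finally show ?thesis by simp
qed

text \<open>Inside each member of \<open>R\<close> the set \<open>T\<close> already supplies the one
  permitted point, so an extension of \<open>T\<close> amounts to an arbitrary transversal of
  \<open>S - R\<close>.\<close>

lemma transversals_containing:
  assumes "disjoint S" "R \<subseteq> S" "T \<in> transversals R"
  shows "{K \<in> transversals S. T \<subseteq> K} = (\<union>) T ` transversals (S - R)"
    and "inj_on ((\<union>) T) (transversals (S - R))"
proof -
  have disj: "A \<inter> B = {}" if "A \<in> R" "B \<in> S - R" for A B
    by (rule disjointD[OF assms(1)]) (use assms(2) that in auto)
  have T: "T \<subseteq> \<Union>R" "\<And>B. B \<in> R \<Longrightarrow> \<exists>x. T \<inter> B = {x}"
    using assms(3) by (auto simp: transversals_def)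
  have TB: "T \<inter> B = {}" if B: "B \<in> S - R" for B
  proof -
    have "T \<inter> B \<subseteq> (\<Union>A\<in>R. A \<inter> B)" using T(1) by auto
    with disj[OF _ B] show ?thesis by simp
  qed
  have LB: "L \<inter> B = {}" if "L \<in> transversals (S - R)" "B \<in> R" for L B
    using disj[OF that(2)] transversals_subset[OF that(1)] by blast
  have TL: "T \<inter> L = {}" if "L \<in> transversals (S - R)" for L
    using LB[OF that] T(1) by blast
  show "inj_on ((\<union>) T) (transversals (S - R))"
    by (rule inj_on_inverseI[of _ "\<lambda>K. K - T"]) (use TL in blast)
  show "{K \<in> transversals S. T \<subseteq> K} = (\<union>) T ` transversals (S - R)"
  proof (intro equalityI subsetI)
    fix K assume "K \<in> {K \<in> transversals S. T \<subseteq> K}"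
    then have K: "K \<subseteq> \<Union>S" "\<And>B. B \<in> S \<Longrightarrow> \<exists>x. K \<inter> B = {x}" "T \<subseteq> K"
      by (auto simp: transversals_def)
    have KB: "K \<inter> B = T \<inter> B" if B: "B \<in> R" for B
    proof -
      obtain x where "K \<inter> B = {x}" using K(2)[OF subsetD[OF assms(2) B]] by (elim exE)
      moreover obtain y where "T \<inter> B = {y}" using T(2)[OF B] by (elim exE)
      moreover have "T \<inter> B \<subseteq> K \<inter> B" using K(3) by auto
      ultimately show ?thesis by simp
    qed
    have eq: "(K - T) \<inter> B = K \<inter> B" if "B \<in> S - R" for B using TB[OF that] by blast
    have "K - T \<subseteq> \<Union>(S - R)" using K(1) KB by blast
    then have "K - T \<in> transversals (S - R)"
      using K(2) by (simp add: transversals_def eq)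
    then show "K \<in> (\<union>) T ` transversals (S - R)"
      using K(3) by (auto intro!: image_eqI[of _ _ "K - T"])
  next
    fix K assume "K \<in> (\<union>) T ` transversals (S - R)"
    then obtain L where L: "K = T \<union> L" "L \<in> transversals (S - R)" by auto
    have "\<exists>x. K \<inter> B = {x}" if "B \<in> S" for B
    proof (cases "B \<in> R")
      case True
      then have "K \<inter> B = T \<inter> B" using LB[OF L(2)] L(1) by blast
      then show ?thesis using T(2)[OF True] by simp
    next
      case False
      then have "K \<inter> B = L \<inter> B" using TB[of B] that L(1) by blast
      then show ?thesis using L(2) that False by (simp add: transversals_def)
    qed
    moreover have "K \<subseteq> \<Union>S" using L(1) transversals_subset[OF L(2)] T(1) assms(2) by blast
    ultimately show "K \<in> {K \<in> transversals S. T \<subseteq> K}"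
      using L(1) by (simp add: transversals_def)
  qed
qed

section \<open>Existence of minima by compactness\<close>

text \<open>A continuous cost attains its minimum on a nonempty closed subset of a compact box;
  \<open>g\<close> witnesses nonemptiness. Covers use \<open>D = {1..}\<close>, decompositions
  \<open>D = {1}\<close>.\<close>

lemma attained_on_box:
  fixes D :: "real set" and a :: "'a \<Rightarrow> real"
  assumes fin: "finite X" and D: "closed D"
    and X: "\<And>T. T \<in> I \<Longrightarrow> Y T \<subseteq> X"
    and g: "\<And>K. K \<in> X \<Longrightarrow> 0 \<le> g K \<and> g K \<le> 1" "\<And>T. T \<in> I \<Longrightarrow> sum g (Y T) \<in> D"
  obtains f where "\<And>K. K \<in> X \<Longrightarrow> 0 \<le> f K" "\<And>T. T \<in> I \<Longrightarrow> sum f (Y T) \<in> D"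
    "\<And>h. (\<And>K. K \<in> X \<Longrightarrow> 0 \<le> h K \<and> h K \<le> 1) \<Longrightarrow> (\<And>T. T \<in> I \<Longrightarrow> sum h (Y T) \<in> D)
       \<Longrightarrow> (\<Sum>K\<in>X. a K * f K) \<le> (\<Sum>K\<in>X. a K * h K)"
proof -
  \<comment> \<open>Coordinates outside \<open>X\<close> are pinned to \<open>0\<close>, so that the
    product over the whole type is compact. Below, \<open>ext\<close> moves a function into this box
    without changing the sums that matter.\<close>
  define Box where "Box = (\<Pi>\<^sub>E K\<in>UNIV. if K \<in> X then {0..1::real} else {0})"
  define C where "C = Box \<inter> (\<Inter>T\<in>I. (\<lambda>f. sum f (Y T)) -` D)"
  have cont: "continuous_on UNIV (\<lambda>f :: 'a \<Rightarrow> real. \<Sum>K\<in>Z. b K * f K)" for Z b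
    by (intro continuous_intros continuous_on_product_coordinates)
  have "compactin (product_topology (\<lambda>_. euclidean) UNIV) Box"
    unfolding Box_def by (subst compactin_PiE) auto
  then have "compact Box" by (simp add: euclidean_product_topology)
  moreover have "closed (\<Inter>T\<in>I. (\<lambda>f. sum f (Y T)) -` D)"
    using cont[of "\<lambda>_. 1"] D by (intro closed_INT ballI closed_vimage) simp_all
  ultimately have "compact C" unfolding C_def by (rule compact_Int_closed)
  define ext where "ext h = (\<lambda>K. if K \<in> X then h K else 0)" for h :: "'a \<Rightarrow> real"
  have sum_ext: "sum (ext h) (Y T) = sum h (Y T)" if "T \<in> I" for h T
    using X[OF that] by (intro sum.cong) (auto simp: ext_def)
  have ext: "ext h \<in> C" if "\<And>K. K \<in> X \<Longrightarrow> 0 \<le> h K \<and> h K \<le> 1" "\<And>T. T \<in> I \<Longrightarrow> sum h (Y T) \<in> D" for h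
    using that by (auto simp: C_def Box_def sum_ext) (auto simp: ext_def)
  have "C \<noteq> {}" using ext[OF g] by auto
  moreover have "continuous_on C (\<lambda>f. \<Sum>K\<in>X. a K * f K)"
    using cont continuous_on_subset by blast
  ultimately obtain f where f: "f \<in> C" "\<And>h. h \<in> C \<Longrightarrow> (\<Sum>K\<in>X. a K * f K) \<le> (\<Sum>K\<in>X. a K * h K)"
    using continuous_attains_inf[OF \<open>compact C\<close>] by blast
  show ?thesis
  proof (rule that)
    fix K assume "K \<in> X"
    moreover have "f K \<in> (if K \<in> X then {0..1} else {0})"
      using f(1) by (simp add: C_def Box_def PiE_iff)
    ultimately show "0 \<le> f K" by simp
  next
    fix T assume "T \<in> I"
    with f(1) show "sum f (Y T) \<in> D" by (auto simp: C_def)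
  next
    fix h assume h: "\<And>K. K \<in> X \<Longrightarrow> 0 \<le> h K \<and> h K \<le> 1" "\<And>T. T \<in> I \<Longrightarrow> sum h (Y T) \<in> D"
    have "(\<Sum>K\<in>X. a K * f K) \<le> (\<Sum>K\<in>X. a K * ext h K)" by (rule f(2)[OF ext[OF h]])
    also have "\<dots> = (\<Sum>K\<in>X. a K * h K)" by (intro sum.cong) (auto simp: ext_def)
    finally show "(\<Sum>K\<in>X. a K * f K) \<le> (\<Sum>K\<in>X. a K * h K)" .
  qed
qed

text \<open>\<open>LEAST\<close> on the reals can be evaluated only through an actual minimiser,
  here \<open>f\<close>; \<open>g\<close> is any feasible competitor.\<close>

lemma Least_le_of_attained:
  fixes v :: "'a \<Rightarrow> real"
  assumes "F f" "\<And>h. F h \<Longrightarrow> v f \<le> v h" "F g"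
  shows "(LEAST x. \<exists>f. F f \<and> x = v f) \<le> v g"
proof -
  have "(LEAST x. \<exists>f. F f \<and> x = v f) = v f"
    using assms(1,2) by (intro Least_equality) auto
  with assms(2,3) show ?thesis by simp
qed

lemma finite_cliques: "finite (verts G) \<Longrightarrow> finite (cliques G)"
  by (rule finite_subset[of _ "Pow (verts G)"]) (auto simp: cliques_def)

text \<open>For the existence of a minimum, weights are truncated (or set to \<open>0\<close> on small cliques) so
  that they range over a compact box.\<close>

lemma frac_cov_le:
  fixes c :: "nat \<Rightarrow> real"
  assumes fin: "finite (verts G)" and c: "\<And>i. i \<ge> 1 \<Longrightarrow> c i \<ge> 0" and g: "frac_clique_cover G t g"
  shows "frac_cov t G c \<le> clique_cost G c g"
proof -
  have finK: "finite (cliques G)" using fin by (rule finite_cliques)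
  have card1: "card K \<ge> 1" if "K \<in> cliques G" for K
    using that fin finite_subset[of K "verts G"] by (auto simp: cliques_def Suc_le_eq card_gt_0_iff)
  define cut where "cut h = (\<lambda>K. min 1 (h K))" for h :: "'a set \<Rightarrow> real"
  have cut: "0 \<le> cut h K \<and> cut h K \<le> 1" if "frac_clique_cover G t h" "K \<in> cliques G" for h K
    using that by (auto simp: cut_def frac_clique_cover_def)
  \<comment> \<open>Either some weight above \<open>T\<close> exceeds \<open>1\<close>, and its
    truncation alone covers \<open>T\<close>, or truncation leaves every weight above
    \<open>T\<close> unchanged.\<close>
  have cut_sum: "1 \<le> (\<Sum>K | K \<in> cliques G \<and> T \<subseteq> K. cut h K)"
    if h: "frac_clique_cover G t h" and T: "T \<in> cliques_of_size G t" for h T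
  proof (cases "\<exists>K. K \<in> cliques G \<and> T \<subseteq> K \<and> h K > 1")
    case True
    then obtain K where K: "K \<in> cliques G" "T \<subseteq> K" "h K > 1" by blast
    have "cut h K \<le> (\<Sum>K | K \<in> cliques G \<and> T \<subseteq> K. cut h K)"
      by (rule member_le_sum) (use K cut[OF h] finK in auto)
    then show ?thesis using K by (simp add: cut_def)
  next
    case False
    then have "cut h K = h K" if "K \<in> cliques G" "T \<subseteq> K" for K
      using that by (simp add: cut_def not_less)
    then have "(\<Sum>K | K \<in> cliques G \<and> T \<subseteq> K. cut h K) = (\<Sum>K | K \<in> cliques G \<and> T \<subseteq> K. h K)"
      by simp
    then show ?thesis using h T by (simp add: frac_clique_cover_def)
  qed
  obtain f where f: "\<And>K. K \<in> cliques G \<Longrightarrow> 0 \<le> f K"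
    "\<And>T. T \<in> cliques_of_size G t \<Longrightarrow> (\<Sum>K | K \<in> cliques G \<and> T \<subseteq> K. f K) \<in> {1..}"
    "\<And>h. (\<And>K. K \<in> cliques G \<Longrightarrow> 0 \<le> h K \<and> h K \<le> 1)
      \<Longrightarrow> (\<And>T. T \<in> cliques_of_size G t \<Longrightarrow> (\<Sum>K | K \<in> cliques G \<and> T \<subseteq> K. h K) \<in> {1..})
      \<Longrightarrow> (\<Sum>K\<in>cliques G. c (card K) * f K) \<le> (\<Sum>K\<in>cliques G. c (card K) * h K)"
    by (rule attained_on_box[OF finK, of "{1..}" "cliques_of_size G t" "\<lambda>T. {K. K \<in> cliques G \<and> T \<subseteq> K}" "cut g" "\<lambda>K. c (card K)"])
       (use cut[OF g] cut_sum[OF g] in auto)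
  show ?thesis
    unfolding frac_cov_def
  proof (rule Least_le_of_attained[where v = "clique_cost G c" and f = f])
    show "frac_clique_cover G t f" using f by (auto simp: frac_clique_cover_def)
    fix h assume h: "frac_clique_cover G t h"
    have "clique_cost G c f \<le> clique_cost G c (cut h)"
      unfolding clique_cost_def using cut[OF h] cut_sum[OF h] by (intro f(3)) auto
    also have "\<dots> \<le> clique_cost G c h"
      unfolding clique_cost_def using c card1 by (intro sum_mono mult_left_mono) (auto simp: cut_def)
    finally show "clique_cost G c f \<le> clique_cost G c h" .
  qed (rule g)
qed

lemma frac_dec_le:
  fixes c :: "nat \<Rightarrow> real"
  assumes fin: "finite (verts G)" and c: "\<And>i. i \<ge> 1 \<Longrightarrow> c i \<ge> 0" and t: "t \<ge> 1"
    and g: "frac_clique_decomposition G t g"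
  shows "frac_dec t G c \<le> clique_cost G c g"
proof -
  have finK: "finite (cliques G)" using fin by (rule finite_cliques)
  have card1: "card K \<ge> 1" if "K \<in> cliques G" for K
    using that fin finite_subset[of K "verts G"] by (auto simp: cliques_def Suc_le_eq card_gt_0_iff)
  define cut where "cut h = (\<lambda>K. if card K < t then 0 else h K)" for h :: "'a set \<Rightarrow> real"
  have cut: "0 \<le> cut h K \<and> cut h K \<le> 1" if h: "frac_clique_decomposition G t h" and K: "K \<in> cliques G" for h K
  proof (cases "card K < t")
    case False
    \<comment> \<open>The clique contains a \<open>t\<close>-clique \<open>T\<close>, and
      \<open>h K\<close> is one of the nonnegative summands that add up to \<open>1\<close> at
      \<open>T\<close>.\<close>
    then obtain T where T: "T \<subseteq> K" "card T = t" by (meson obtain_subset_with_card_n not_less)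
    with t have "T \<noteq> {}" by auto
    with T K have Tc: "T \<in> cliques_of_size G t" by (auto simp: cliques_of_size_def cliques_def)
    have "h K \<le> (\<Sum>K | K \<in> cliques G \<and> T \<subseteq> K. h K)"
      by (rule member_le_sum) (use K T h finK in \<open>auto simp: frac_clique_decomposition_def\<close>)
    with Tc h K show ?thesis by (auto simp: cut_def frac_clique_decomposition_def)
  qed (simp add: cut_def)
  have cut_sum: "(\<Sum>K | K \<in> cliques G \<and> T \<subseteq> K. cut h K) = 1"
    if h: "frac_clique_decomposition G t h" and T: "T \<in> cliques_of_size G t" for h T
  proof -
    have ge: "t \<le> card K" if "K \<in> cliques G" "T \<subseteq> K" for K
      using that T fin by (auto simp: cliques_def cliques_of_size_def intro!: card_mono finite_subset[of K])
    have "cut h K = h K" if "K \<in> cliques G" "T \<subseteq> K" for K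
      using ge[OF that] by (simp add: cut_def)
    then have "(\<Sum>K | K \<in> cliques G \<and> T \<subseteq> K. cut h K) = (\<Sum>K | K \<in> cliques G \<and> T \<subseteq> K. h K)"
      by simp
    then show ?thesis using h T by (simp add: frac_clique_decomposition_def)
  qed
  obtain f where f: "\<And>K. K \<in> cliques G \<Longrightarrow> 0 \<le> f K"
    "\<And>T. T \<in> cliques_of_size G t \<Longrightarrow> (\<Sum>K | K \<in> cliques G \<and> T \<subseteq> K. f K) \<in> {1}"
    "\<And>h. (\<And>K. K \<in> cliques G \<Longrightarrow> 0 \<le> h K \<and> h K \<le> 1)
      \<Longrightarrow> (\<And>T. T \<in> cliques_of_size G t \<Longrightarrow> (\<Sum>K | K \<in> cliques G \<and> T \<subseteq> K. h K) \<in> {1})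
      \<Longrightarrow> (\<Sum>K\<in>cliques G. c (card K) * f K) \<le> (\<Sum>K\<in>cliques G. c (card K) * h K)"
    by (rule attained_on_box[OF finK, of "{1}" "cliques_of_size G t" "\<lambda>T. {K. K \<in> cliques G \<and> T \<subseteq> K}" "cut g" "\<lambda>K. c (card K)"])
       (use cut[OF g] cut_sum[OF g] in auto)
  show ?thesis
    unfolding frac_dec_def
  proof (rule Least_le_of_attained[where v = "clique_cost G c" and f = f])
    show "frac_clique_decomposition G t f" using f by (auto simp: frac_clique_decomposition_def)
    fix h assume h: "frac_clique_decomposition G t h"
    have "clique_cost G c f \<le> clique_cost G c (cut h)"
      unfolding clique_cost_def using cut[OF h] cut_sum[OF h] by (intro f(3)) auto
    also have "\<dots> \<le> clique_cost G c h"
      unfolding clique_cost_def using c card1 h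
      by (intro sum_mono mult_left_mono) (auto simp: cut_def frac_clique_decomposition_def)
    finally show "clique_cost G c f \<le> clique_cost G c h" .
  qed (rule g)
qed

section \<open>Exact values when \<open>t\<close> bounds the clique sizes, and comparison with the
  Turan graph\<close>

text \<open>A \<open>t\<close>-clique then lies in no other clique, so its constraint involves its
  own weight alone. The indicator of the \<open>t\<close>-cliques is therefore optimal for all four
  problems.\<close>

lemma exact_on_bounded_cliques:
  fixes c :: "nat \<Rightarrow> real"
  assumes fin: "finite (verts G)" and t: "t \<ge> 1" and bound: "\<And>K. K \<in> cliques G \<Longrightarrow> card K \<le> t"
    and c: "\<And>i. i \<ge> 1 \<Longrightarrow> c i \<ge> 0"
  defines "v \<equiv> c t * card (cliques_of_size G t)"
  shows "frac_cov t G c = v" "cov t G c = v" "frac_dec t G c = v" "dec t G c = v"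
proof -
  define g where "g = (\<lambda>K :: 'a set. of_bool (card K = t) :: real)"
  have finK: "finite (cliques G)" using fin by (rule finite_cliques)
  have finC: "finite K" "card K \<ge> 1" if "K \<in> cliques G" for K
    using that fin finite_subset[of K "verts G"] by (auto simp: cliques_def Suc_le_eq card_gt_0_iff)
  have only: "{K. K \<in> cliques G \<and> T \<subseteq> K} = {T}" if "T \<in> cliques_of_size G t" for T
    using that bound finC(1) card_seteq by (auto simp: cliques_of_size_def)
  have dec: "clique_decomposition G t g"
    unfolding clique_decomposition_def using only by (simp add: g_def cliques_of_size_def)
  then have others: "clique_cover G t g" "frac_clique_cover G t g" "frac_clique_decomposition G t g"
    by (auto simp: clique_decomposition_def clique_cover_def frac_clique_cover_def
      frac_clique_decomposition_def g_def)
  have cost: "clique_cost G c g = v"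
  proof -
    have "clique_cost G c g = (\<Sum>K\<in>cliques G. if card K = t then c t else 0)"
      unfolding clique_cost_def g_def by (intro sum.cong) auto
    also have "\<dots> = (\<Sum>K\<in>cliques_of_size G t. c t)"
      unfolding cliques_of_size_def by (rule sum.inter_filter[OF finK, symmetric])
    finally show ?thesis by (simp add: v_def)
  qed
  have lower: "v \<le> clique_cost G c f" if f: "frac_clique_cover G t f" for f
  proof -
    have "v = (\<Sum>K\<in>cliques_of_size G t. c (card K) * 1)"
      by (simp add: v_def cliques_of_size_def)
    also have "\<dots> \<le> (\<Sum>K\<in>cliques_of_size G t. c (card K) * f K)"
    proof (intro sum_mono mult_left_mono)
      fix K assume K: "K \<in> cliques_of_size G t"
      then have "1 \<le> (\<Sum>L | L \<in> cliques G \<and> K \<subseteq> L. f L)"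
        using f unfolding frac_clique_cover_def by blast
      then show "1 \<le> f K" by (simp add: only[OF K])
      show "0 \<le> c (card K)" using K t c by (simp add: cliques_of_size_def)
    qed
    also have "\<dots> \<le> clique_cost G c f"
      unfolding clique_cost_def using f finK finC c
      by (intro sum_mono2) (auto simp: cliques_of_size_def frac_clique_cover_def)
    finally show ?thesis .
  qed
  \<comment> \<open>Feasible functions of the other three problems are fractional covers, so the
    single lower bound serves all four.\<close>
  have imp: "frac_clique_cover G t f" if "clique_cover G t f \<or> frac_clique_decomposition G t f
      \<or> clique_decomposition G t f" for f
    using that by (fastforce simp: clique_decomposition_def clique_cover_def frac_clique_cover_def
      frac_clique_decomposition_def)
  show "frac_cov t G c = v" "cov t G c = v" "frac_dec t G c = v" "dec t G c = v"
    unfolding frac_cov_def cov_def frac_dec_def dec_def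
    using dec others cost lower imp by (auto intro!: Least_equality)
qed

text \<open>The members of \<open>Q\<close> and the set \<open>U\<close> of all remaining vertices
  form \<open>k\<close> blocks with total size \<open>n\<close>; the balanced sizes of the Turan
  graph maximise the product.\<close>

lemma prod_parts_le_turan:
  assumes "is_turan_graph n k T" and P: "partition_on V P" "finite V" "card V = n"
    and Q: "Q \<subseteq> P" "card Q + 1 = k"
  obtains R where "complete_multipartite_with T R" "card R = k"
    "(\<Prod>B\<in>Q. card B) * (n - (\<Sum>B\<in>Q. card B)) \<le> (\<Prod>B\<in>R. card B)"
proof -
  from assms(1) obtain R where R: "card (verts T) = n" "complete_multipartite_with T R" "card R = k"
    "\<forall>A\<in>R. \<forall>B\<in>R. card A \<le> card B + 1"
    by (auto simp: is_turan_graph_def)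
  have partR: "partition_on (verts T) R" "finite (verts T)"
    using R(2) by (auto simp: complete_multipartite_with_def simple_graph_def)
  have finR: "finite R" using finite_elements[OF partR(2,1)] .
  have finQ: "finite Q" using finite_elements[OF P(2,1)] Q(1) finite_subset by auto
  have finB: "finite B" if "B \<in> Q" for B
    using that P(2) Q(1) partition_onD1[OF P(1)] by (blast intro: finite_subset)
  have disjQ: "disjoint Q" using P(1) Q(1) by (meson disjoint_def partition_onD2 subsetD)
  define U where "U = V - \<Union>Q"
  have subQ: "\<Union>Q \<subseteq> V" using P(1) Q(1) by (auto simp: partition_on_def)
  have cQ: "card (\<Union>Q) = (\<Sum>B\<in>Q. card B)"
    using finB disjQ by (intro card_Union_disjoint) (auto simp: pairwise_def disjnt_def disjoint_def)
  have cU: "card U = n - (\<Sum>B\<in>Q. card B)" "(\<Sum>B\<in>Q. card B) \<le> n"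
    using subQ P(2,3) cQ card_mono[OF P(2) subQ] by (auto simp: U_def card_Diff_subset finite_subset)
  \<comment> \<open>Otherwise \<open>insert U Q\<close> would have only \<open>k - 1\<close> blocks.
    \<open>U\<close> itself may be empty, but parts are not.\<close>
  have "U \<notin> Q"
  proof
    assume "U \<in> Q"
    then have "U = {}" by (auto simp: U_def)
    with \<open>U \<in> Q\<close> Q(1) partition_onD3[OF P(1)] show False by auto
  qed
  have "prod card (insert U Q) \<le> prod card R"
  proof (rule balanced_prod_ge)
    show "card (insert U Q) = card R" using \<open>U \<notin> Q\<close> finQ Q(2) R(3) by simp
    have "sum card R = n"
    proof -
      have "finite B" if "B \<in> R" for B
        using that partR(2) partition_onD1[OF partR(1)] by (auto intro: finite_subset)
      then show ?thesis using product_partition[OF partR(1)] R(1) by simp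
    qed
    then show "sum card (insert U Q) = sum card R"
      using \<open>U \<notin> Q\<close> finQ cU by simp
    show "card j > 0" if j: "j \<in> R" for j
    proof -
      have "j \<noteq> {}" using j partition_onD3[OF partR(1)] by auto
      moreover have "j \<subseteq> verts T" using j partition_onD1[OF partR(1)] by auto
      ultimately show ?thesis using partR(2) by (simp add: card_gt_0_iff finite_subset)
    qed
  qed (use finQ finR R(4) in auto)
  with \<open>U \<notin> Q\<close> finQ cU R(2,3) that show ?thesis by (simp add: mult.commute)
qed

section \<open>Cliques of a complete multipartite graph as transversals, and spreading of
  weights\<close>

locale multipartite =
  fixes G :: "'a sgraph" and P :: "'a set set"
  assumes multipartite: "complete_multipartite_with G P"
begin

lemma finite_verts: "finite (verts G)"
  using multipartite by (simp add: complete_multipartite_with_def simple_graph_def)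

lemma part: "partition_on (verts G) P"
  using multipartite by (simp add: complete_multipartite_with_def)

lemma finite_parts: "finite P"
  using finite_elements[OF finite_verts part] .

lemma disjoint_parts: "disjoint P"
  using part by (rule partition_onD2)

lemma disjoint_subset: "S \<subseteq> P \<Longrightarrow> disjoint S"
  by (rule disjointI, rule disjointD[OF disjoint_parts]) auto

lemma Union_parts: "\<Union>P = verts G"
  using partition_onD1[OF part] ..

lemma finite_part: "B \<in> P \<Longrightarrow> finite B"
  using finite_verts Union_parts by (auto intro: finite_subset)

lemma card_part_pos: "B \<in> P \<Longrightarrow> card B > 0"
  using finite_part partition_onD3[OF part] by (auto simp: card_gt_0_iff)

lemma sum_card_parts: "(\<Sum>B\<in>P. card B) = card (verts G)"
  using product_partition[OF part] finite_part by simp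

definition hit :: "'a set \<Rightarrow> 'a set set" where
  "hit K = {B \<in> P. K \<inter> B \<noteq> {}}"

lemma hit_transversal:
  assumes "S \<subseteq> P" "K \<in> transversals S"
  shows "hit K = S"
proof (intro equalityI subsetI)
  fix B assume "B \<in> hit K"
  then obtain x where x: "B \<in> P" "x \<in> K" "x \<in> B" by (auto simp: hit_def)
  with transversals_subset[OF assms(2)] obtain A where A: "A \<in> S" "x \<in> A" by auto
  then have "A = B"
    using disjointD[OF disjoint_parts, of A B] x assms(1) by auto
  with A show "B \<in> S" by simp
next
  fix B assume "B \<in> S"
  with assms show "B \<in> hit K" by (force simp: hit_def transversals_def)
qed

lemma transversal_clique:
  assumes "S \<subseteq> P" "K \<in> transversals S" "S \<noteq> {}"
  shows "K \<in> cliques G"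
proof -
  have KB: "\<exists>x. K \<inter> B = {x}" if "B \<in> S" for B using assms(2) that by (simp add: transversals_def)
  have "K \<noteq> {}" using KB assms(3) by auto
  moreover have sub: "K \<subseteq> verts G"
    using transversals_subset[OF assms(2)] assms(1) Union_parts by auto
  moreover have "{u, v} \<in> edges G" if uv: "u \<in> K" "v \<in> K" "u \<noteq> v" for u v
  proof -
    have "\<not> (u \<in> B \<and> v \<in> B)" if "B \<in> P" for B
    proof
      assume B: "u \<in> B \<and> v \<in> B"
      then have "B \<in> hit K" using uv that by (auto simp: hit_def)
      then obtain x where "K \<inter> B = {x}" using KB hit_transversal[OF assms(1,2)] by auto
      with B uv have "u = x" "v = x" by auto
      with uv show False by simp
    qed
    moreover have "u \<in> verts G" "v \<in> verts G" using uv sub by auto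
    ultimately show ?thesis
      using multipartite unfolding complete_multipartite_with_def by blast
  qed
  ultimately show ?thesis by (simp add: cliques_def)
qed

text \<open>Vertices in a common part are not adjacent, so a clique has at most one vertex in each
  part.\<close>

lemma clique_transversal:
  assumes "K \<in> cliques G"
  shows "K \<in> transversals (hit K)" "hit K \<noteq> {}"
proof -
  have K: "K \<noteq> {}" "K \<subseteq> \<Union>P" using assms Union_parts by (auto simp: cliques_def)
  then have sub: "K \<subseteq> \<Union>(hit K)" by (auto simp: hit_def)
  with K show "hit K \<noteq> {}" by auto
  have "\<exists>x. K \<inter> B = {x}" if "B \<in> hit K" for B
  proof -
    from that obtain x where x: "B \<in> P" "x \<in> K" "x \<in> B" by (auto simp: hit_def)
    have "y = x" if y: "y \<in> K" "y \<in> B" for y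
    proof (rule ccontr)
      assume "y \<noteq> x"
      then have "{y, x} \<in> edges G" using assms x y by (simp add: cliques_def)
      moreover have "x \<in> verts G" "y \<in> verts G" using x y assms by (auto simp: cliques_def)
      ultimately have "\<not> (\<exists>A\<in>P. y \<in> A \<and> x \<in> A)"
        using multipartite by (simp add: complete_multipartite_with_def)
      with x y show False by simp
    qed
    then have "K \<inter> B \<subseteq> {x}" by blast
    with x(2,3) have "K \<inter> B = {x}" by blast
    then show ?thesis ..
  qed
  with sub show "K \<in> transversals (hit K)" by (simp add: transversals_def)
qed

lemma hit_subset: "hit K \<subseteq> P"
  by (auto simp: hit_def)

lemma card_clique: "K \<in> cliques G \<Longrightarrow> card K = card (hit K)"
  by (rule card_transversal[OF finite_subset[OF hit_subset finite_parts]
    disjoint_subset[OF hit_subset] clique_transversal(1)])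

lemma card_transversals_containing:
  assumes "T \<in> transversals R" "R \<subseteq> S" "S \<subseteq> P"
  shows "card {K \<in> transversals S. T \<subseteq> K} = (\<Prod>B\<in>S - R. card B)"
proof -
  have "card {K \<in> transversals S. T \<subseteq> K} = card (transversals (S - R))"
    using assms transversals_containing[OF disjoint_subset] by (simp add: card_image)
  also have "\<dots> = (\<Prod>B\<in>S - R. card B)"
    using assms(3) finite_parts finite_part
    by (intro card_transversals disjoint_subset) (auto intro: finite_subset)
  finally show ?thesis .
qed

text \<open>The denominator is the number of transversals of \<open>hit K\<close>, so for nonempty
  \<open>S \<subseteq> P\<close> the cliques hitting exactly \<open>S\<close> have total weight
  \<open>W S\<close>.\<close>

definition spread :: "('a set set \<Rightarrow> real) \<Rightarrow> 'a set \<Rightarrow> real" where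
  "spread W K = W (hit K) / (\<Prod>B\<in>hit K. card B)"

text \<open>The cliques above \<open>T\<close> are grouped by the set \<open>S\<close> of parts they
  hit. The number of transversals of \<open>S\<close> above \<open>T\<close> is the product of the
  sizes in \<open>S - R\<close>, which cancels all of the denominator except the factors from
  \<open>R\<close>. Taking \<open>a = 1\<close> gives the constraints; \<open>a = c\<close> with
  \<open>T = R = {}\<close> gives the cost.\<close>

lemma sum_spread:
  assumes T: "T \<in> transversals R" "R \<subseteq> P"
  shows "(\<Sum>K | K \<in> cliques G \<and> T \<subseteq> K. a (card K) * spread W K)
    = (\<Sum>S | S \<subseteq> P \<and> S \<noteq> {} \<and> R \<subseteq> S. a (card S) * W S) / (\<Prod>B\<in>R. card B)"
proof -
  define X where "X = {K. K \<in> cliques G \<and> T \<subseteq> K}"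
  \<comment> \<open>For \<open>R = {}\<close> the empty \<open>S\<close> has to be excluded: its
    only transversal is \<open>{}\<close>, which is not a clique.\<close>
  define Y where "Y = {S. S \<subseteq> P \<and> S \<noteq> {} \<and> R \<subseteq> S}"
  have fin: "finite X" "finite Y"
    using finite_cliques[OF finite_verts] finite_parts by (auto simp: X_def Y_def)
  have "hit ` X \<subseteq> Y"
  proof
    fix S assume "S \<in> hit ` X"
    then obtain K where K: "K \<in> cliques G" "T \<subseteq> K" "S = hit K" by (auto simp: X_def)
    then have "hit T \<subseteq> S" by (auto simp: hit_def)
    with hit_transversal[OF T(2,1)] clique_transversal(2)[OF K(1)] K(3) hit_subset[of K]
    show "S \<in> Y" by (simp add: Y_def)
  qed
  have fiber: "{K \<in> X. hit K = S} = {K \<in> transversals S. T \<subseteq> K}" if "S \<in> Y" for S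
    using that clique_transversal(1) transversal_clique hit_transversal by (auto simp: X_def Y_def)
  have "(\<Sum>K\<in>X. a (card K) * spread W K)
      = (\<Sum>K\<in>X. a (card (hit K)) * W (hit K) / (\<Prod>B\<in>hit K. card B))"
    by (intro sum.cong) (simp_all add: X_def card_clique spread_def)
  also have "\<dots> = (\<Sum>S\<in>Y. \<Sum>K\<in>{K \<in> X. hit K = S}. a (card (hit K)) * W (hit K) / (\<Prod>B\<in>hit K. card B))"
    by (rule sum.group[symmetric]) (use fin \<open>hit ` X \<subseteq> Y\<close> in auto)
  also have "\<dots> = (\<Sum>S\<in>Y. a (card S) * W S / (\<Prod>B\<in>R. card B))"
  proof (rule sum.cong[OF refl])
    fix S assume S: "S \<in> Y"
    then have S': "R \<subseteq> S" "S \<subseteq> P" by (auto simp: Y_def)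
    have "finite S" using S'(2) finite_parts finite_subset by auto
    then have "(\<Prod>B\<in>S. card B) = (\<Prod>B\<in>S - R. card B) * (\<Prod>B\<in>R. card B)"
      by (rule prod.subset_diff[OF S'(1)])
    moreover have "(\<Prod>B\<in>S - R. card B) > 0"
      using S'(2) card_part_pos by (intro prod_pos) auto
    moreover have "(\<Sum>K\<in>{K \<in> X. hit K = S}. a (card (hit K)) * W (hit K) / (\<Prod>B\<in>hit K. card B))
        = (\<Sum>K\<in>{K \<in> X. hit K = S}. a (card S) * W S / (\<Prod>B\<in>S. card B))"
      by (intro sum.cong) auto
    moreover have "\<dots> = real (\<Prod>B\<in>S - R. card B) * (a (card S) * W S / (\<Prod>B\<in>S. card B))"
      by (simp add: fiber[OF S] card_transversals_containing[OF T(1) S'])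
    ultimately show "(\<Sum>K\<in>{K \<in> X. hit K = S}. a (card (hit K)) * W (hit K) / (\<Prod>B\<in>hit K. card B))
        = a (card S) * W S / (\<Prod>B\<in>R. card B)"
      by (simp del: of_nat_prod)
  qed
  finally show ?thesis by (simp add: X_def Y_def sum_divide_distrib)
qed

lemma cost_spread:
  "clique_cost G c (spread W) = (\<Sum>S | S \<subseteq> P \<and> S \<noteq> {}. c (card S) * W S)"
  using sum_spread[of "{}" "{}" c W] by (simp add: clique_cost_def transversals_def)

lemma sum_spread_clique:
  assumes "T \<in> cliques_of_size G t"
  obtains R where "R \<subseteq> P" "card R = t" "R \<noteq> {}"
    "(\<Sum>K | K \<in> cliques G \<and> T \<subseteq> K. spread W K) = (\<Sum>S | R \<subseteq> S \<and> S \<subseteq> P. W S) / (\<Prod>B\<in>R. card B)"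
proof (rule that[of "hit T"])
  have T: "T \<in> cliques G" "card T = t" using assms by (auto simp: cliques_of_size_def)
  show "hit T \<subseteq> P" by (rule hit_subset)
  show "card (hit T) = t" using T by (simp add: card_clique)
  show ne: "hit T \<noteq> {}" using T(1) by (rule clique_transversal)
  have "{S. S \<subseteq> P \<and> S \<noteq> {} \<and> hit T \<subseteq> S} = {S. hit T \<subseteq> S \<and> S \<subseteq> P}" using ne by auto
  then show "(\<Sum>K | K \<in> cliques G \<and> T \<subseteq> K. spread W K)
      = (\<Sum>S | hit T \<subseteq> S \<and> S \<subseteq> P. W S) / (\<Prod>B\<in>hit T. card B)"
    using sum_spread[OF clique_transversal(1)[OF T(1)] hit_subset, of "\<lambda>_. 1" W] by simp
qed

lemma spread_nonneg:
  assumes "\<And>S. S \<subseteq> P \<Longrightarrow> 0 \<le> W S"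
  shows "0 \<le> spread W K"
  unfolding spread_def by (intro divide_nonneg_nonneg assms hit_subset) (simp add: prod_nonneg)

text \<open>A clique with as many vertices as there are parts hits every part, hence is a
  transversal of \<open>P\<close>.\<close>

lemma card_maximum_cliques: "P \<noteq> {} \<Longrightarrow> card (cliques_of_size G (card P)) = (\<Prod>B\<in>P. card B)"
proof -
  assume ne: "P \<noteq> {}"
  have "cliques_of_size G (card P) = transversals P"
  proof (intro equalityI subsetI)
    fix K assume K: "K \<in> cliques_of_size G (card P)"
    then have "card (hit K) = card P" "K \<in> cliques G" by (auto simp: cliques_of_size_def card_clique)
    then show "K \<in> transversals P"
      using card_subset_eq[OF finite_parts hit_subset] clique_transversal(1) by metis
  next
    fix K assume K: "K \<in> transversals P"
    then show "K \<in> cliques_of_size G (card P)"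
      using transversal_clique[OF subset_refl K ne] card_clique hit_transversal[OF subset_refl K]
      by (simp add: cliques_of_size_def)
  qed
  then show ?thesis using card_transversals[OF finite_parts disjoint_parts finite_part] by simp
qed

lemma card_clique_le: "K \<in> cliques G \<Longrightarrow> card K \<le> card P"
  using card_clique card_mono[OF finite_parts hit_subset] by simp

end

section \<open>Linear bounds on the cost sequence, and a double count\<close>

lemma linear_growth_bound:
  fixes c :: "nat \<Rightarrow> real"
  assumes step: "\<And>i. i \<ge> t \<Longrightarrow> c (i + 1) - c i \<le> d" and "c t \<le> d" "i \<ge> t"
  shows "c i \<le> d * (real i - real t + 1)"
  using \<open>i \<ge> t\<close>
proof (induction i rule: dec_induct)
  case base
  show ?case using \<open>c t \<le> d\<close> by simp
next
  case (step n)
  then have "c (Suc n) \<le> c n + d" using assms(1)[of n] by simp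
  with step.IH show ?case by (simp add: algebra_simps)
qed

text \<open>By concavity no increment exceeds the first one, \<open>c 2 - c 1\<close>, which is at
  most \<open>c 2\<close>.\<close>

lemma concave_growth_bound:
  fixes c :: "nat \<Rightarrow> real"
  assumes concave: "\<And>i. i \<ge> 2 \<Longrightarrow> 2 * c i \<ge> c (i - 1) + c (i + 1)" and "c 1 \<ge> 0" "i \<ge> 2"
  shows "c i \<le> c 2 * (real i - 1)"
proof -
  have "c (i + 1) - c i \<le> c 2" if "i \<ge> 1" for i
    using that
  proof (induction i rule: dec_induct)
    case base
    show ?case using \<open>c 1 \<ge> 0\<close> by (simp add: numeral_2_eq_2)
  next
    case (step n)
    with concave[of "Suc n"] show ?case by simp
  qed
  then show ?thesis
    using linear_growth_bound[of 2 c "c 2" i] \<open>i \<ge> 2\<close> by simp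
qed

text \<open>The weights count the indices \<open>i\<close> by their value \<open>l i\<close>;
  swapping the sums turns a sum over sets into a sum over indices.\<close>

lemma sum_mult_fibers:
  fixes h :: "'b \<Rightarrow> real"
  assumes "finite X" "finite I"
  shows "(\<Sum>S\<in>X. h S * (A * (\<Sum>i\<in>I. of_bool (l i = S)))) = A * (\<Sum>i\<in>I. if l i \<in> X then h (l i) else 0)"
proof -
  have "(\<Sum>S\<in>X. h S * (A * (\<Sum>i\<in>I. of_bool (l i = S)))) = A * (\<Sum>S\<in>X. \<Sum>i\<in>I. if l i = S then h S else 0)"
    unfolding sum_distrib_left by (intro sum.cong refl) simp
  also have "(\<Sum>S\<in>X. \<Sum>i\<in>I. if l i = S then h S else 0) = (\<Sum>i\<in>I. \<Sum>S\<in>X. if l i = S then h S else 0)"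
    by (rule sum.swap)
  also have "\<dots> = (\<Sum>i\<in>I. if l i \<in> X then h (l i) else 0)"
    using assms(1) by (simp add: sum.delta)
  finally show ?thesis .
qed

section \<open>The two upper bounds for complete multipartite graphs\<close>

context multipartite
begin

text \<open>A \<open>t\<close>-clique with set of parts \<open>R\<close> receives \<open>A\<close>
  times the smallest size in \<open>R\<close>, divided by the product over \<open>R\<close>. This is
  at least \<open>1\<close>, since the other \<open>t - 1\<close> sizes have product at most
  \<open>A\<close>.\<close>

lemma frac_cov_le_top_parts:
  fixes c :: "nat \<Rightarrow> real"
  assumes t: "1 \<le> t" "t \<le> card P"
    and c: "\<And>i. i \<ge> 1 \<Longrightarrow> c i \<ge> 0" "\<And>i. i \<ge> t \<Longrightarrow> c (i + 1) - c i \<le> c t"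
  obtains Q where "Q \<subseteq> P" "card Q + 1 = t"
    "frac_cov t G c \<le> c t * real ((\<Prod>B\<in>Q. card B) * (card (verts G) - (\<Sum>B\<in>Q. card B)))"
proof -
  have "t - 1 < card P" using t by simp
  then obtain Q m where Q: "Q \<subseteq> P" "card Q = t - 1" "\<And>B. B \<in> Q \<Longrightarrow> m \<le> card B"
    "\<And>B. B \<in> P - Q \<Longrightarrow> card B \<le> m" "\<exists>B\<in>P - Q. card B = m"
    using obtain_top_subset[OF finite_parts, of "t - 1" card] by metis
  have finQ: "finite Q" using Q(1) finite_parts finite_subset by auto
  define A where "A = (\<Prod>B\<in>Q. card B)"
  define level where "level \<theta> = {B \<in> P. \<theta> \<le> card B}" for \<theta>
  \<comment> \<open>Different thresholds can give the same set of parts; each of them contributes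
    \<open>A\<close>.\<close>
  define W where "W S = real A * (\<Sum>\<theta>=1..m. of_bool (level \<theta> = S))" for S
  have W: "(\<Sum>S\<in>X. h S * W S) = real A * (\<Sum>\<theta>=1..m. if level \<theta> \<in> X then h (level \<theta>) else 0)"
    if "finite X" for X h
    unfolding W_def by (rule sum_mult_fibers) (use that in auto)
  have finX: "finite {S. S \<subseteq> P \<and> \<phi> S}" for \<phi>
    using finite_parts by simp
  have cover: "frac_clique_cover G t (spread W)"
    unfolding frac_clique_cover_def
  proof (intro conjI ballI)
    fix K assume "K \<in> cliques G"
    show "0 \<le> spread W K" by (rule spread_nonneg) (simp add: W_def sum_nonneg)
  next
    fix T assume "T \<in> cliques_of_size G t"
    then obtain R where R: "R \<subseteq> P" "card R = t" "R \<noteq> {}" and sum: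
      "(\<Sum>K | K \<in> cliques G \<and> T \<subseteq> K. spread W K) = (\<Sum>S | R \<subseteq> S \<and> S \<subseteq> P. W S) / (\<Prod>B\<in>R. card B)"
      by (rule sum_spread_clique)
    have finR: "finite R" using R(1) finite_parts finite_subset by auto
    have "Min (card ` R) \<in> card ` R" using finR R(3) by (intro Min_in) auto
    then obtain B0 where B0: "B0 \<in> R" "card B0 = Min (card ` R)" by auto
    have B0_le: "card B0 \<le> card B" if "B \<in> R" for B using that finR B0(2) by simp
    \<comment> \<open>\<open>R\<close> has one part more than \<open>Q\<close>, so some part of
      \<open>R\<close> lies outside \<open>Q\<close> and has size at most \<open>m\<close>. Hence
      all thresholds up to the minimum size in \<open>R\<close> occur among
      \<open>1..m\<close>.\<close>
    have "\<not> R \<subseteq> Q" using card_mono[OF finQ, of R] Q(2) R(2) t by auto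
    then obtain B1 where "B1 \<in> R - Q" by auto
    with B0_le Q(4) R(1) have B0m: "card B0 \<le> m" using order_trans by blast
    have "(\<Sum>S | R \<subseteq> S \<and> S \<subseteq> P. W S) = real A * (\<Sum>\<theta>=1..m. if R \<subseteq> level \<theta> then 1 else 0)"
    proof -
      have "{S. R \<subseteq> S \<and> S \<subseteq> P} = {S. S \<subseteq> P \<and> R \<subseteq> S}" by auto
      moreover have "level \<theta> \<subseteq> P" for \<theta> by (auto simp: level_def)
      ultimately show ?thesis
        using W[OF finX[of "\<lambda>S. R \<subseteq> S"], of "\<lambda>_. 1"] by simp
    qed
    also have "(\<Sum>\<theta>=1..m. if R \<subseteq> level \<theta> then 1 else 0) = real (card {\<theta> \<in> {1..m}. R \<subseteq> level \<theta>})"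
      by (simp flip: sum.inter_filter)
    also have "{\<theta> \<in> {1..m}. R \<subseteq> level \<theta>} = {1..card B0}"
    proof (intro equalityI subsetI)
      fix \<theta> assume "\<theta> \<in> {\<theta> \<in> {1..m}. R \<subseteq> level \<theta>}"
      with B0(1) show "\<theta> \<in> {1..card B0}" by (auto simp: level_def)
    next
      fix \<theta> assume "\<theta> \<in> {1..card B0}"
      with B0_le B0m R(1) show "\<theta> \<in> {\<theta> \<in> {1..m}. R \<subseteq> level \<theta>}"
        by (auto simp: level_def intro: order_trans)
    qed
    finally have "(\<Sum>S | R \<subseteq> S \<and> S \<subseteq> P. W S) = real (A * card B0)" by simp
    moreover have "(\<Prod>B\<in>R. card B) \<le> A * card B0"
    proof -
      have "(\<Prod>B\<in>R - {B0}. card B) \<le> A"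
        unfolding A_def
        by (rule prod_le_top[OF finite_parts Q(1), where m = m]) (use R Q B0(1) finR in auto)
      then show ?thesis using prod.remove[OF finR B0(1), of card] by (simp add: mult.commute)
    qed
    moreover have "(\<Prod>B\<in>R. card B) > 0" using R(1) card_part_pos by (intro prod_pos) auto
    ultimately show "1 \<le> (\<Sum>K | K \<in> cliques G \<and> T \<subseteq> K. spread W K)"
      unfolding sum by (simp del: of_nat_mult of_nat_prod)
  qed
  \<comment> \<open>Up to threshold \<open>m\<close> a level contains all of \<open>Q\<close> and
    the part of size \<open>m\<close> outside \<open>Q\<close>. So it has at least \<open>t\<close>
    parts, where the growth bound starts.\<close>
  have card_level: "card (level \<theta>) = (t - 1) + card {B \<in> P - Q. \<theta> \<le> card B}" "t \<le> card (level \<theta>)"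
    if "\<theta> \<in> {1..m}" for \<theta>
  proof -
    have "level \<theta> = Q \<union> {B \<in> P - Q. \<theta> \<le> card B}"
      using Q(1,3) that by (auto simp: level_def intro: order_trans)
    moreover have "card (Q \<union> {B \<in> P - Q. \<theta> \<le> card B}) = card Q + card {B \<in> P - Q. \<theta> \<le> card B}"
      using finQ finite_parts by (intro card_Un_disjoint) auto
    ultimately show eq: "card (level \<theta>) = (t - 1) + card {B \<in> P - Q. \<theta> \<le> card B}"
      using Q(2) by simp
    have "{B \<in> P - Q. \<theta> \<le> card B} \<noteq> {}" using Q(5) that by auto
    then have "card {B \<in> P - Q. \<theta> \<le> card B} > 0" using finite_parts by (simp add: card_gt_0_iff)
    with eq show "t \<le> card (level \<theta>)" using t by linarith
  qed
  \<comment> \<open>Layer counting: a part \<open>B\<close> outside \<open>Q\<close> is counted at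
    the thresholds \<open>1..card B\<close>, all of which are at most \<open>m\<close>.\<close>
  have layers: "(\<Sum>\<theta>=1..m. card {B \<in> P - Q. \<theta> \<le> card B}) = (\<Sum>B\<in>P - Q. card B)"
  proof -
    have "(\<Sum>\<theta>=1..m. card {B \<in> P - Q. \<theta> \<le> card B}) = (\<Sum>\<theta>=1..m. \<Sum>B\<in>P - Q. if \<theta> \<le> card B then 1 else 0)"
      using finite_parts by (simp flip: sum.inter_filter)
    also have "\<dots> = (\<Sum>B\<in>P - Q. \<Sum>\<theta>=1..m. if \<theta> \<le> card B then 1 else 0)"
      by (rule sum.swap)
    also have "\<dots> = (\<Sum>B\<in>P - Q. card B)"
    proof (rule sum.cong[OF refl])
      fix B assume "B \<in> P - Q"
      with Q(4) have "card B \<le> m" by blast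
      then have "{\<theta> \<in> {1..m}. \<theta> \<le> card B} = {1..card B}" by auto
      then show "(\<Sum>\<theta>=1..m. if \<theta> \<le> card B then 1 else 0) = card B"
        by (simp flip: sum.inter_filter)
    qed
    finally show ?thesis .
  qed
  have split: "card (verts G) - (\<Sum>B\<in>Q. card B) = (\<Sum>B\<in>P - Q. card B)"
    using sum.subset_diff[OF Q(1) finite_parts, of card] sum_card_parts by simp
  have "clique_cost G c (spread W) = (\<Sum>S | S \<subseteq> P \<and> S \<noteq> {}. c (card S) * W S)"
    by (rule cost_spread)
  also have "\<dots> = real A * (\<Sum>\<theta>=1..m. if level \<theta> \<in> {S. S \<subseteq> P \<and> S \<noteq> {}} then c (card (level \<theta>)) else 0)"
    by (rule W[OF finX])
  also have "\<dots> \<le> real A * (\<Sum>\<theta>=1..m. c t * real (card {B \<in> P - Q. \<theta> \<le> card B}))"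
  proof (intro mult_left_mono sum_mono)
    fix \<theta> assume \<theta>: "\<theta> \<in> {1..m}"
    have "c (card (level \<theta>)) \<le> c t * (real (card (level \<theta>)) - real t + 1)"
      by (rule linear_growth_bound) (use c card_level[OF \<theta>] in auto)
    also have "real (card (level \<theta>)) - real t + 1 = real (card {B \<in> P - Q. \<theta> \<le> card B})"
      using card_level(1)[OF \<theta>] t by simp
    finally show "(if level \<theta> \<in> {S. S \<subseteq> P \<and> S \<noteq> {}} then c (card (level \<theta>)) else 0)
        \<le> c t * real (card {B \<in> P - Q. \<theta> \<le> card B})"
      using c(1)[OF t(1)] by simp
  qed simp
  also have "\<dots> = c t * real (A * (\<Sum>\<theta>=1..m. card {B \<in> P - Q. \<theta> \<le> card B}))"
    by (simp add: sum_distrib_left mult_ac)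
  also have "\<dots> = c t * real (A * (card (verts G) - (\<Sum>B\<in>Q. card B)))"
    by (simp only: layers split)
  finally have "frac_cov t G c \<le> c t * real (A * (card (verts G) - (\<Sum>B\<in>Q. card B)))"
    using frac_cov_le[where c = c, OF finite_verts c(1) cover] by linarith
  with Q(1,2) t that show ?thesis by (simp add: A_def)
qed

text \<open>Two parts are chosen together with probability equal to the product of their sizes over
  \<open>a^2\<close>, which makes each constraint exact. The cost is at most
  \<open>c 2 * a^2\<close> times the expected number of chosen parts minus one.\<close>

lemma frac_dec_le_largest_part:
  fixes c :: "nat \<Rightarrow> real"
  assumes ne: "P \<noteq> {}"
    and c: "\<And>i. i \<ge> 1 \<Longrightarrow> c i \<ge> 0" "\<And>i. i \<ge> 2 \<Longrightarrow> 2 * c i \<ge> c (i - 1) + c (i + 1)"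
  obtains B where "B \<in> P" "frac_dec 2 G c \<le> c 2 * real (card B * (card (verts G) - card B))"
proof -
  have "Max (card ` P) \<in> card ` P" using finite_parts ne by (intro Max_in) auto
  then obtain B0 where B0: "B0 \<in> P" "card B0 = Max (card ` P)" by auto
  define a where "a = real (card B0)"
  have a0: "a > 0" using card_part_pos[OF B0(1)] by (simp add: a_def)
  have le_a: "real (card B) \<le> a" if "B \<in> P" for B
    using that finite_parts B0(2) by (simp add: a_def)
  \<comment> \<open>\<open>x B\<close> and \<open>y B\<close> are the probabilities of choosing and
    omitting \<open>B\<close>; \<open>p S\<close> is the probability that exactly the parts in
    \<open>S\<close> are chosen.\<close>
  define x where "x B = real (card B) / a" for B :: "'a set"
  define y where "y B = 1 - x B" for B :: "'a set"
  define p where "p S = prod x S * prod y (P - S)" for S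
  \<comment> \<open>Singletons affect no constraint on 2-cliques, but would add cost through
    \<open>c 1\<close>.\<close>
  define W where "W S = (if card S < 2 then 0 else a\<^sup>2 * p S)" for S
  have xy: "0 \<le> x B" "0 \<le> y B" if "B \<in> P" for B
    using le_a[OF that] a0 by (auto simp: x_def y_def)
  have p0: "0 \<le> p S" if "S \<subseteq> P" for S
    unfolding p_def using that by (intro mult_nonneg_nonneg prod_nonneg xy) auto
  have marginal: "(\<Sum>S | R \<subseteq> S \<and> S \<subseteq> P. p S) = prod x R" if "R \<subseteq> P" for R
    unfolding p_def using sum_Pow_prod[OF finite_parts that, of x y] by (simp add: y_def)
  have decomposition: "frac_clique_decomposition G 2 (spread W)"
    unfolding frac_clique_decomposition_def
  proof (intro conjI ballI)
    fix K assume "K \<in> cliques G"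
    show "0 \<le> spread W K" by (rule spread_nonneg) (simp add: W_def p0)
  next
    fix T assume "T \<in> cliques_of_size G 2"
    then obtain R where R: "R \<subseteq> P" "card R = 2" and sum:
      "(\<Sum>K | K \<in> cliques G \<and> T \<subseteq> K. spread W K) = (\<Sum>S | R \<subseteq> S \<and> S \<subseteq> P. W S) / (\<Prod>B\<in>R. card B)"
      by (rule sum_spread_clique)
    have "(\<Sum>S | R \<subseteq> S \<and> S \<subseteq> P. W S) = (\<Sum>S | R \<subseteq> S \<and> S \<subseteq> P. a\<^sup>2 * p S)"
    proof (intro sum.cong refl)
      fix S assume S: "S \<in> {S. R \<subseteq> S \<and> S \<subseteq> P}"
      then have "finite S" using finite_parts finite_subset by auto
      with S have "2 \<le> card S" using card_mono[of S R] R(2) by auto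
      then show "W S = a\<^sup>2 * p S" by (simp add: W_def)
    qed
    also have "\<dots> = a\<^sup>2 * prod x R" using marginal[OF R(1)] by (simp flip: sum_distrib_left)
    also have "\<dots> = (\<Prod>B\<in>R. card B)" using a0 R(2) by (simp add: x_def prod_dividef)
    finally have "(\<Sum>S | R \<subseteq> S \<and> S \<subseteq> P. W S) = (\<Prod>B\<in>R. card B)" .
    moreover have "(\<Prod>B\<in>R. card B) > 0" using R(1) card_part_pos by (intro prod_pos) auto
    ultimately show "(\<Sum>K | K \<in> cliques G \<and> T \<subseteq> K. spread W K) = 1"
      unfolding sum by (simp del: of_nat_prod)
  qed
  \<comment> \<open>Linearity of expectation: the probability of choosing \<open>B\<close> is the
    marginal for \<open>R = {B}\<close>.\<close>
  have mean: "(\<Sum>S\<in>Pow P. real (card S) * p S) = sum x P"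
  proof -
    have "(\<Sum>S\<in>Pow P. real (card S) * p S) = (\<Sum>S\<in>Pow P. \<Sum>B\<in>P. if B \<in> S then p S else 0)"
    proof (rule sum.cong[OF refl])
      fix S assume "S \<in> Pow P"
      then have "{B \<in> P. B \<in> S} = S" by auto
      then show "real (card S) * p S = (\<Sum>B\<in>P. if B \<in> S then p S else 0)"
        using finite_parts by (simp flip: sum.inter_filter)
    qed
    also have "\<dots> = (\<Sum>B\<in>P. \<Sum>S\<in>Pow P. if B \<in> S then p S else 0)" by (rule sum.swap)
    also have "\<dots> = (\<Sum>B\<in>P. x B)"
    proof (rule sum.cong[OF refl])
      fix B assume B: "B \<in> P"
      have "{S \<in> Pow P. B \<in> S} = {S. {B} \<subseteq> S \<and> S \<subseteq> P}" by auto
      then show "(\<Sum>S\<in>Pow P. if B \<in> S then p S else 0) = x B"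
        using marginal[of "{B}"] B finite_parts by (simp flip: sum.inter_filter)
    qed
    finally show ?thesis .
  qed
  have total: "(\<Sum>S\<in>Pow P. p S) = 1"
    using marginal[of "{}"] by (simp add: Pow_def)
  have sum_x: "sum x P = real (card (verts G)) / a"
    unfolding x_def using sum_card_parts by (simp flip: sum_divide_distrib of_nat_sum)
  \<comment> \<open>A part of maximum size has \<open>x = 1\<close> and is always chosen. Without
    this, the empty set would make a negative contribution to the bound on the cost, as
    \<open>card S - 1\<close> is \<open>-1\<close> there.\<close>
  have p_empty: "p {} = 0"
  proof -
    have "y B0 = 0" using a0 by (simp add: y_def x_def a_def)
    then have "prod y P = 0" using finite_parts B0(1) by (intro prod_zero) auto
    then show ?thesis by (simp add: p_def)
  qed
  have "clique_cost G c (spread W) = (\<Sum>S | S \<subseteq> P \<and> S \<noteq> {}. c (card S) * W S)"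
    by (rule cost_spread)
  also have "\<dots> = (\<Sum>S\<in>Pow P. c (card S) * W S)"
    using finite_parts by (intro sum.mono_neutral_left) (auto simp: W_def)
  also have "\<dots> \<le> (\<Sum>S\<in>Pow P. c 2 * a\<^sup>2 * ((real (card S) - 1) * p S))"
  proof (rule sum_mono)
    fix S assume S: "S \<in> Pow P"
    then have finS: "finite S" using finite_parts finite_subset by auto
    consider "S = {}" | "card S = 1" | "card S \<ge> 2" using finS card_0_eq[OF finS] by linarith
    then show "c (card S) * W S \<le> c 2 * a\<^sup>2 * ((real (card S) - 1) * p S)"
    proof cases
      case 3
      have "c (card S) \<le> c 2 * (real (card S) - 1)"
        using c 3 by (intro concave_growth_bound) auto
      then have "c (card S) * (a\<^sup>2 * p S) \<le> c 2 * (real (card S) - 1) * (a\<^sup>2 * p S)"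
        using p0 S by (intro mult_right_mono) auto
      with 3 show ?thesis by (simp add: W_def mult_ac)
    qed (simp_all add: W_def p_empty)
  qed
  also have "\<dots> = c 2 * a\<^sup>2 * (sum x P - 1)"
    unfolding sum_distrib_left[symmetric] left_diff_distrib sum_subtractf mean by (simp add: total)
  also have "\<dots> = c 2 * real (card B0 * (card (verts G) - card B0))"
  proof -
    have "card B0 \<le> card (verts G)"
      using B0(1) Union_parts by (intro card_mono finite_verts) auto
    then have "real (card B0 * (card (verts G) - card B0)) = a * (real (card (verts G)) - a)"
      by (simp add: a_def of_nat_diff)
    moreover have "a\<^sup>2 * (sum x P - 1) = a * (real (card (verts G)) - a)"
      using a0 by (simp add: sum_x field_simps power2_eq_square)
    ultimately show ?thesis by (simp add: mult.assoc)
  qed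
  finally have "frac_dec 2 G c \<le> c 2 * real (card B0 * (card (verts G) - card B0))"
    using frac_dec_le[where c = c, OF finite_verts c(1) _ decomposition] by simp
  with B0(1) show ?thesis by (rule that)
qed

end

section \<open>Values on the Turan graph and conclusion\<close>

text \<open>With exactly \<open>t\<close> parts no clique exceeds \<open>t\<close> vertices, and the
  \<open>t\<close>-cliques are the transversals of \<open>R\<close>.\<close>

lemma turan_costs:
  fixes T :: "'b sgraph" and c :: "nat \<Rightarrow> real"
  assumes "complete_multipartite_with T R" "card R = t" "t \<ge> 1" "\<And>i. i \<ge> 1 \<Longrightarrow> c i \<ge> 0"
  shows "frac_cov t T c = c t * real (\<Prod>B\<in>R. card B)" "cov t T c = c t * real (\<Prod>B\<in>R. card B)"
    "frac_dec t T c = c t * real (\<Prod>B\<in>R. card B)" "dec t T c = c t * real (\<Prod>B\<in>R. card B)"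
proof -
  interpret multipartite T R by unfold_locales (rule assms)
  have "R \<noteq> {}" using assms(2,3) by auto
  then have n: "card (cliques_of_size T t) = (\<Prod>B\<in>R. card B)"
    using card_maximum_cliques assms(2) by simp
  have "card K \<le> t" if "K \<in> cliques T" for K using card_clique_le[OF that] assms(2) by simp
  from exact_on_bounded_cliques[OF finite_verts assms(3) this assms(4)]
  show "frac_cov t T c = c t * real (\<Prod>B\<in>R. card B)" "cov t T c = c t * real (\<Prod>B\<in>R. card B)"
    "frac_dec t T c = c t * real (\<Prod>B\<in>R. card B)" "dec t T c = c t * real (\<Prod>B\<in>R. card B)"
    unfolding n by simp_all
qed

theorem theorem1p8:
  fixes H :: "'a sgraph" and n t :: nat and c :: "nat \<Rightarrow> real"
  assumes "complete_multipartite H" and "card (verts H) = n"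
    and "t \<ge> 2" and "n \<ge> t"
    and "\<forall>i\<ge>1. c i \<ge> 0"
  shows "((\<forall>i\<ge>t. c (i + 1) - c i \<le> c t) \<longrightarrow>
            (\<forall>T :: 'b sgraph. is_turan_graph n t T \<longrightarrow>
               frac_cov t H c \<le> frac_cov t T c \<and> frac_cov t T c = cov t T c))
       \<and> ((\<forall>i\<ge>2. 2 * c i \<ge> c (i - 1) + c (i + 1)) \<longrightarrow>
            (\<forall>T :: 'b sgraph. is_turan_graph n 2 T \<longrightarrow>
               frac_dec 2 H c \<le> frac_dec 2 T c \<and> frac_dec 2 T c = dec 2 T c))"
proof -
  obtain P where P: "complete_multipartite_with H P"
    using assms(1) by (auto simp: complete_multipartite_def)
  interpret multipartite H P by unfold_locales (rule P)
  have c0: "c i \<ge> 0" if "i \<ge> 1" for i using assms(5) that by simp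
  have t1: "t \<ge> 1" using assms(3) by simp
  have "frac_cov t H c \<le> frac_cov t T c \<and> frac_cov t T c = cov t T c"
    if step: "\<And>i. i \<ge> t \<Longrightarrow> c (i + 1) - c i \<le> c t" and T: "is_turan_graph n t T" for T :: "'b sgraph"
  proof (cases "t \<le> card P")
    case True
    obtain Q where Q: "Q \<subseteq> P" "card Q + 1 = t" and le:
      "frac_cov t H c \<le> c t * real ((\<Prod>B\<in>Q. card B) * (card (verts H) - (\<Sum>B\<in>Q. card B)))"
      using frac_cov_le_top_parts[OF t1 True c0 step] by blast
    obtain R where R: "complete_multipartite_with T R" "card R = t"
      "(\<Prod>B\<in>Q. card B) * (n - (\<Sum>B\<in>Q. card B)) \<le> (\<Prod>B\<in>R. card B)"
      by (rule prod_parts_le_turan[OF T part finite_verts assms(2) Q])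
    have "c t * real ((\<Prod>B\<in>Q. card B) * (n - (\<Sum>B\<in>Q. card B))) \<le> c t * real (\<Prod>B\<in>R. card B)"
      using R(3) c0[OF t1] by (intro mult_left_mono of_nat_mono)
    with le show ?thesis
      using turan_costs[where c = c, OF R(1,2) t1 c0] assms(2) by simp
  next
    case False
    \<comment> \<open>With fewer than \<open>t\<close> parts there is nothing to cover, so the zero
      function is a cover and nonnegativity of the Turan value suffices.\<close>
    have "cliques_of_size H t = {}"
      using card_clique_le False by (fastforce simp: cliques_of_size_def)
    then have "frac_clique_cover H t (\<lambda>_. 0)" by (simp add: frac_clique_cover_def)
    then have le: "frac_cov t H c \<le> 0"
      using frac_cov_le[where c = c, OF finite_verts c0] by (fastforce simp: clique_cost_def)
    obtain R where R: "complete_multipartite_with T R" "card R = t"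
      using T by (auto simp: is_turan_graph_def)
    have "0 \<le> c t * real (\<Prod>B\<in>R. card B)"
      by (intro mult_nonneg_nonneg c0[OF t1] of_nat_0_le_iff)
    with le show ?thesis
      using turan_costs[where c = c, OF R t1 c0] by simp
  qed
  moreover have "frac_dec 2 H c \<le> frac_dec 2 T c \<and> frac_dec 2 T c = dec 2 T c"
    if concave: "\<And>i. i \<ge> 2 \<Longrightarrow> 2 * c i \<ge> c (i - 1) + c (i + 1)" and T: "is_turan_graph n 2 T"
    for T :: "'b sgraph"
  proof -
    have "P \<noteq> {}" using Union_parts assms(2-4) by auto
    then obtain B where B: "B \<in> P" and le: "frac_dec 2 H c \<le> c 2 * real (card B * (card (verts H) - card B))"
      using frac_dec_le_largest_part[OF _ c0 concave] by blast
    \<comment> \<open>For \<open>k = 2\<close> the family \<open>Q\<close> is the single largest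
      part, and all other vertices form the second block.\<close>
    obtain R where R: "complete_multipartite_with T R" "card R = 2"
      "(\<Prod>B\<in>{B}. card B) * (n - (\<Sum>B\<in>{B}. card B)) \<le> (\<Prod>B\<in>R. card B)"
      by (rule prod_parts_le_turan[OF T part finite_verts assms(2), of "{B}"]) (use B in auto)
    have "c 2 * real (card B * (n - card B)) \<le> c 2 * real (\<Prod>B\<in>R. card B)"
      using R(3) c0[of 2] by (intro mult_left_mono of_nat_mono) simp_all
    with le show ?thesis
      using turan_costs[where c = c, OF R(1,2) _ c0] assms(2) by simp
  qed
  ultimately show ?thesis by blast
qed

end
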